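(* Let $k\ge 2$, let $0=r_0<r_1<\dots<r_k$ be integers, $d=\gcd(r_1,\dots,r_k)$, $S=\langle r_1,\dots,r_k\rangle$, and let $n\ge r_k^4$ be an integer with $\gcd(n,d)=1$. Let $M_n=\langle n,n+r_1,\dots,n+r_k\rangle$ and let $\operatorname{F}(M_n)\equiv i\bmod n$ with $i\in\operatorname{Ap}(S,dn)$. Then $i\in P_n''$ and $$\operatorname{F}(M_{n+\lambda r_k})=\varphi_n^\lambda(\operatorname{F}(M_n))=\operatorname{F}(M_n)+(\mathbf{m}(i)+(\lambda+1)d-1)\lambda r_k+\lambda dn$$ for every $\lambda\in\mathbb{N}$.
   Context: $\mathbb{N}$ includes $0$, and $\langle a_1,\dots,a_s\rangle=\{\sum\lambda_i a_i\mid\lambda_i\in\mathbb{N}\}$. For a numerical semigroup $H$, $\operatorname{F}(H)=\max(\mathbb{Z}\setminus H)$ and $\operatorname{PF}(H)=\{x\in\mathbb{Z}\setminus H\mid x+h\in H\ \forall\, 0\neq h\in H\}$. For the monoid $S$, $\operatorname{F}(S)=\max\{s\in\mathbb{Z}\setminus S\mid s\equiv0\bmod d\}$ (possibly negative); $N_0=\max\{r_k^2,r_k^2+\operatorname{F}(S)r_k\}$ (one has $N_0<r_k^4$). $\operatorname{Ap}(S,dn)=\{s\in S\mid s-dn\notin S\}$. For $i\in S$, $\mathbf{m}(i)$ is the minimum of $\lambda_1+\dots+\lambda_k$ over all expressions $i=\lambda_1r_1+\dots+\lambda_kr_k$ with $\lambda_j\in\mathbb{N}$. For $n>N_0$ with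 $\gcd(n,d)=1$: $P_n=\{i\in\operatorname{Ap}(S,dn)\mid f\equiv i\bmod n\text{ for some }f\in\operatorname{PF}(M_n)\}$, $P_n''=\{i\in P_n\mid i\ge dn-r_k\}$. Each $f\in\operatorname{PF}(M_n)$ is congruent mod $n$ to a unique $i\in P_n$, and this gives a bijection $\operatorname{PF}(M_n)\to P_n$. The map $\psi_n:P_n\to P_{n+r_k}$, $\psi_n(i)=i$ if $i<dn-r_k$ and $\psi_n(i)=i+dr_k$ if $i\ge dn-r_k$, is a bijection, and $\varphi_n:\operatorname{PF}(M_n)\to\operatorname{PF}(M_{n+r_k})$ is the induced bijection: if $f\equiv i\bmod n$ with $i\in P_n$, then $\varphi_n(f)$ is the unique element of $\operatorname{PF}(M_{n+r_k})$ congruent to $\psi_n(i)$ mod $n+r_k$. Put $\varphi_n^\lambda=\varphi_{n+(\lambda-1)r_k}\circ\dots\circ\varphi_{n+r_k}\circ\varphi_n$ ($\varphi_n^0=\mathrm{id}$). *)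

theory Defs
  imports Complex_Main "HOL-Number_Theory.Cong"
begin

definition generated :: "nat set \<Rightarrow> (nat \<Rightarrow> int) \<Rightarrow> int set" where
  "generated J a = {\<Sum>j\<in>J. int (l j) * a j | l :: nat \<Rightarrow> nat. True}"

text \<open>Frobenius number: the maximum of \<open>\<int> \<setminus> H\<close>, an infinite set, hence \<open>GREATEST\<close> and not \<open>Max\<close>.\<close>

definition Frob :: "int set \<Rightarrow> int" where
  "Frob H = (GREATEST x. x \<notin> H)"

definition PF :: "int set \<Rightarrow> int set" where
  "PF H = {x. x \<notin> H \<and> (\<forall>h\<in>H. h \<noteq> 0 \<longrightarrow> x + h \<in> H)}"

definition Ap :: "int set \<Rightarrow> int \<Rightarrow> int set" where
  "Ap H x = {s \<in> H. s - x \<notin> H}"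

text \<open>Throughout, \<open>r 0 = 0 < r 1 < \<dots> < r k\<close>; values of \<open>r\<close> outside \<open>{0..k}\<close> are irrelevant.\<close>

definition dgcd :: "(nat \<Rightarrow> int) \<Rightarrow> nat \<Rightarrow> int" where
  "dgcd r k = (GCD j\<in>{1..k}. r j)"

definition S :: "(nat \<Rightarrow> int) \<Rightarrow> nat \<Rightarrow> int set" where
  "S r k = generated {1..k} r"

definition M :: "(nat \<Rightarrow> int) \<Rightarrow> nat \<Rightarrow> int \<Rightarrow> int set" where
  "M r k n = generated {0..k} (\<lambda>j. n + r j)"

definition minlen :: "(nat \<Rightarrow> int) \<Rightarrow> nat \<Rightarrow> int \<Rightarrow> nat" where
  "minlen r k i =
     (LEAST t. \<exists>l :: nat \<Rightarrow> nat. i = (\<Sum>j\<in>{1..k}. int (l j) * r j) \<and> t = (\<Sum>j\<in>{1..k}. l j))"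

definition P :: "(nat \<Rightarrow> int) \<Rightarrow> nat \<Rightarrow> int \<Rightarrow> int set" where
  "P r k n = {i \<in> Ap (S r k) (dgcd r k * n). \<exists>f\<in>PF (M r k n). [f = i] (mod n)}"

definition P'' :: "(nat \<Rightarrow> int) \<Rightarrow> nat \<Rightarrow> int \<Rightarrow> int set" where
  "P'' r k n = {i \<in> P r k n. i \<ge> dgcd r k * n - r k}"

definition psi :: "(nat \<Rightarrow> int) \<Rightarrow> nat \<Rightarrow> int \<Rightarrow> int \<Rightarrow> int" where
  "psi r k n i = (if i < dgcd r k * n - r k then i else i + dgcd r k * r k)"

text \<open>The map \<open>PF (M\<^sub>n) \<rightarrow> PF (M\<^bsub>n + r k\<^esub>)\<close> induced by \<open>psi\<close>. It is meaningful only for \<open>f \<in> PF (M r k n)\<close> and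
  sufficiently large \<open>n\<close> coprime to \<open>dgcd r k\<close> (\<open>n \<ge> (r k)\<^sup>4\<close> suffices): then the residue class of \<open>f\<close>
  meets \<open>P r k n\<close> in exactly one \<open>i\<close>, and the class of \<open>psi r k n i\<close> contains exactly one
  pseudo-Frobenius number of \<open>M r k (n + r k)\<close>.\<close>

definition phi :: "(nat \<Rightarrow> int) \<Rightarrow> nat \<Rightarrow> int \<Rightarrow> int \<Rightarrow> int" where
  "phi r k n f =
     (THE g. g \<in> PF (M r k (n + r k)) \<and>
        (\<exists>i\<in>P r k n. [f = i] (mod n) \<and> [g = psi r k n i] (mod (n + r k))))"

fun phi_iter :: "(nat \<Rightarrow> int) \<Rightarrow> nat \<Rightarrow> int \<Rightarrow> nat \<Rightarrow> int \<Rightarrow> int" where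
  "phi_iter r k n 0 = id"
| "phi_iter r k n (Suc m) = phi r k (n + int m * r k) \<circ> phi_iter r k n m"

end

theory Submission
  imports Defs
begin

text \<open>
  Write \<open>R = r k\<close> and \<open>m = minlen r k\<close>. A sum of \<open>a\<close> generators of \<open>M\<^sub>n\<close> has the form \<open>a n + s\<close>, where
  \<open>s \<in> S\<close> is a sum of at most \<open>a\<close> of the \<open>r j\<close> with \<open>j \<ge> 1\<close>; so \<open>M\<^sub>n\<close> consists of the numbers \<open>a n + s\<close>
  with \<open>a \<ge> m(s)\<close> (\<open>M_iff\<close>). Within the class of \<open>i \<in> Ap(S, dn)\<close> modulo \<open>n\<close> these are the numbers
  \<open>w(i) + t n\<close>, \<open>t \<ge> 0\<close>, where \<open>w(i) = i + m(i) n\<close> (\<open>M_in_class_iff\<close>). Hence \<open>F(M\<^sub>n)\<close> is the maximum of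
  \<open>w(i) - n\<close> over \<open>i \<in> Ap(S, dn)\<close>, and the theorem is about how the maximizing \<open>i\<close> moves when \<open>n\<close>
  becomes \<open>n + R\<close>.

  The facts needed about \<open>m\<close> rest on one pigeonhole argument (\<open>shortest_list_few_small\<close>): a
  shortest factorization has fewer than \<open>R\<close> entries other than \<open>R\<close>. With the obvious \<open>s \<le> R m(s)\<close>, it
  gives \<open>R m(s) \<le> s + R\<^sup>2\<close>,
  the recursion \<open>m(s + R) = m(s) + 1\<close> for \<open>s \<in> S\<close> with \<open>s \<ge> R\<^sup>2\<close>, and the fact that \<open>S\<close> contains all
  multiples of \<open>d\<close> from \<open>R\<^sup>2\<close> on.

  If \<open>i < dn - R\<close>, then some larger \<open>j \<in> Ap(S, dn)\<close> has \<open>m(j) \<ge> m(i)\<close>, so \<open>i\<close> does not maximize \<open>w\<close>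
  (\<open>Frob_class_large\<close>). The map \<open>j \<mapsto> j + dR\<close> sends the elements of \<open>Ap(S, dn)\<close> that are at least
  \<open>R\<^sup>2\<close> onto the elements of \<open>Ap(S, d(n + R))\<close> that are at least \<open>R\<^sup>2 + dR\<close>, and raises \<open>m\<close> by \<open>d\<close>; as \<open>n\<close>
  is much larger than \<open>R\<close>, the maximizer of \<open>w\<close> also has the largest value of \<open>m\<close>, and its
  image stays the maximizer (\<open>Frob_class_next\<close>). So \<open>F(M\<^bsub>n+R\<^esub>)\<close> lies in the class of \<open>i + dR\<close>,
  which is \<open>\<psi>\<^sub>n(i)\<close>, and \<open>\<phi>\<^sub>n\<close> maps \<open>F(M\<^sub>n)\<close> to \<open>F(M\<^bsub>n+R\<^esub>)\<close>. After \<open>\<lambda>\<close> steps the maximizer is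
  \<open>i + \<lambda>dR\<close> with \<open>m = m(i) + \<lambda>d\<close>, and the formula is \<open>w - n\<close> evaluated there with
  \<open>n + \<lambda>R\<close> in place of \<open>n\<close>.
\<close>

section \<open>Factorizations as lists of generators\<close>

text \<open>Lists, unlike multiplicity functions, can be cut into blocks, which the pigeonhole argument
  needs.\<close>

definition generator_lists :: "(nat \<Rightarrow> int) \<Rightarrow> nat \<Rightarrow> int \<Rightarrow> int list set" where
  "generator_lists r k s = {xs. set xs \<subseteq> r ` {1..k} \<and> sum_list xs = s}"

lemma exists_list_of_multiplicities:
  fixes r :: "nat \<Rightarrow> int" and l :: "nat \<Rightarrow> nat"
  assumes "finite J"
  shows "\<exists>xs. set xs \<subseteq> r ` J \<and> sum_list xs = (\<Sum>j\<in>J. int (l j) * r j) \<and> length xs = (\<Sum>j\<in>J. l j)"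
  using assms
proof (induction J rule: finite_induct)
  case empty
  show ?case by simp
next
  case (insert j J)
  then obtain xs where xs: "set xs \<subseteq> r ` J" "sum_list xs = (\<Sum>j\<in>J. int (l j) * r j)"
      "length xs = (\<Sum>j\<in>J. l j)"
    by blast
  show ?case
    by (rule exI[of _ "replicate (l j) (r j) @ xs"])
      (use xs insert.hyps in \<open>auto simp: sum_list_replicate split: if_splits\<close>)
qed

lemma exists_multiplicities_of_list:
  fixes r :: "nat \<Rightarrow> int"
  assumes "finite J" "set xs \<subseteq> r ` J"
  shows "\<exists>l :: nat \<Rightarrow> nat. sum_list xs = (\<Sum>j\<in>J. int (l j) * r j) \<and> length xs = (\<Sum>j\<in>J. l j)"
  using assms(2)
proof (induction xs)
  case Nil
  show ?case by (rule exI[of _ "\<lambda>_. 0"]) simp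
next
  case (Cons x xs)
  then obtain l :: "nat \<Rightarrow> nat" where l: "sum_list xs = (\<Sum>j\<in>J. int (l j) * r j)"
      "length xs = (\<Sum>j\<in>J. l j)" by auto
  obtain j where j: "j \<in> J" "x = r j" using Cons.prems by auto
  let ?l = "l(j := Suc (l j))"
  have "(\<Sum>j\<in>J. int (?l j) * r j) = int (?l j) * r j + (\<Sum>j\<in>J - {j}. int (l j) * r j)"
    using j assms(1) by (subst sum.remove[of _ j]) (auto intro!: sum.cong)
  moreover have "(\<Sum>j\<in>J. int (l j) * r j) = int (l j) * r j + (\<Sum>j\<in>J - {j}. int (l j) * r j)"
    using j assms(1) by (subst sum.remove[of _ j]) auto
  moreover have "(\<Sum>j\<in>J. ?l j) = ?l j + (\<Sum>j\<in>J - {j}. l j)"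
    using j assms(1) by (subst sum.remove[of _ j]) (auto intro!: sum.cong)
  moreover have "(\<Sum>j\<in>J. l j) = l j + (\<Sum>j\<in>J - {j}. l j)"
    using j assms(1) by (subst sum.remove[of _ j]) auto
  ultimately show ?case
    using l j by (intro exI[of _ ?l]) (auto simp: algebra_simps)
qed

lemma factorization_iff_list:
  "(\<exists>l :: nat \<Rightarrow> nat. s = (\<Sum>j\<in>{1..k}. int (l j) * r j) \<and> t = (\<Sum>j\<in>{1..k}. l j))
    \<longleftrightarrow> (\<exists>xs\<in>generator_lists r k s. length xs = t)" (is "?L \<longleftrightarrow> ?R")
proof
  assume ?L
  then obtain l :: "nat \<Rightarrow> nat" where
    "s = (\<Sum>j\<in>{1..k}. int (l j) * r j)" "t = (\<Sum>j\<in>{1..k}. l j)" by blast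
  with exists_list_of_multiplicities[of "{1..k}" r l] show ?R
    by (auto simp: generator_lists_def)
next
  assume ?R
  then obtain xs where "set xs \<subseteq> r ` {1..k}" "sum_list xs = s" "length xs = t"
    by (auto simp: generator_lists_def)
  moreover from this obtain l :: "nat \<Rightarrow> nat" where
    "sum_list xs = (\<Sum>j\<in>{1..k}. int (l j) * r j)" "length xs = (\<Sum>j\<in>{1..k}. l j)"
    using exists_multiplicities_of_list[of "{1..k}" xs r] by auto
  ultimately show ?L
    by (intro exI[of _ l]) simp
qed

lemma in_S_iff_list: "s \<in> S r k \<longleftrightarrow> (\<exists>xs. xs \<in> generator_lists r k s)"
proof -
  have "s \<in> S r k \<longleftrightarrow>
      (\<exists>t. \<exists>l :: nat \<Rightarrow> nat. s = (\<Sum>j\<in>{1..k}. int (l j) * r j) \<and> t = (\<Sum>j\<in>{1..k}. l j))"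
    by (auto simp: S_def generated_def)
  then show ?thesis
    unfolding factorization_iff_list by blast
qed

lemma minlen_list: "minlen r k s = (LEAST t. \<exists>xs\<in>generator_lists r k s. length xs = t)"
  unfolding minlen_def factorization_iff_list ..

lemma obtain_shortest_list:
  assumes "s \<in> S r k"
  obtains xs where "xs \<in> generator_lists r k s" "length xs = minlen r k s"
proof -
  have "\<exists>t. \<exists>xs\<in>generator_lists r k s. length xs = t"
    using assms by (auto simp: in_S_iff_list)
  then have "\<exists>xs\<in>generator_lists r k s. length xs = minlen r k s"
    unfolding minlen_list by (rule LeastI_ex)
  with that show ?thesis by blast
qed

lemma minlen_le_length:
  assumes "xs \<in> generator_lists r k s"
  shows "minlen r k s \<le> length xs"
  unfolding minlen_list by (rule Least_le) (use assms in blast)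

text \<open>Two of the at least \<open>R + 1\<close> prefix sums agree modulo \<open>R\<close>; the block is what lies between.\<close>

lemma exists_block_sum_dvd:
  fixes xs :: "int list"
  assumes "R > 0" "R \<le> int (length xs)"
  shows "\<exists>ys zs us. xs = ys @ zs @ us \<and> zs \<noteq> [] \<and> R dvd sum_list zs"
proof -
  define p where "p t = sum_list (take t xs) mod R" for t
  have "p ` {0..nat R} \<subseteq> {0..<R}"
    using assms by (auto simp: p_def)
  then have "card (p ` {0..nat R}) \<le> card {0..<R}"
    by (intro card_mono) auto
  also have "\<dots> < card {0..nat R}"
    by simp
  finally have "\<not> inj_on p {0..nat R}"
    by (metis card_image less_irrefl)
  then obtain a b where ab: "a < b" "b \<le> nat R" "p a = p b"
    unfolding inj_on_def by (metis atLeastAtMost_iff linorder_neqE_nat)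
  define zs where "zs = take (b - a) (drop a xs)"
  have tb: "take b xs = take a xs @ zs"
    unfolding zs_def using ab(1) by (metis le_add_diff_inverse less_imp_le take_add)
  have "xs = take a xs @ zs @ drop b xs"
    using tb by (metis append.assoc append_take_drop_id)
  moreover have "zs \<noteq> []"
    using ab assms by (auto simp: zs_def)
  moreover have "R dvd sum_list zs"
    using ab(3) tb unfolding p_def
    by (metis add_diff_cancel_left' mod_eq_dvd_iff sum_list_append)
  ultimately show ?thesis by blast
qed

lemma cong_int_obtain:
  fixes x y n :: int
  assumes "[x = y] (mod n)"
  obtains t where "x = y + t * n"
proof -
  have "n dvd x - y" using assms by (simp add: cong_iff_dvd_diff)
  then obtain t where "x - y = n * t" ..
  then have "x = y + t * n" by (simp add: algebra_simps)
  then show ?thesis by (rule that)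
qed

section \<open>The monoid generated by the shifts\<close>

locale shift_generators =
  fixes r :: "nat \<Rightarrow> int" and k :: nat
  assumes k_ge_2: "2 \<le> k"
    and r_0: "r 0 = 0"
    and r_strict_mono: "strict_mono_on {0..k} r"
begin

abbreviation R :: int where "R \<equiv> r k"
abbreviation d :: int where "d \<equiv> dgcd r k"
abbreviation m :: "int \<Rightarrow> int" where "m s \<equiv> int (minlen r k s)"

lemma r_less: "a < b \<Longrightarrow> b \<le> k \<Longrightarrow> r a < r b"
  using r_strict_mono by (auto simp: strict_mono_on_def)

lemma R_ge_2: "2 \<le> R"
  using r_less[of 0 1] r_less[of 1 k] k_ge_2 r_0 by simp

lemma generator_bounds:
  assumes "x \<in> r ` {1..k}"
  shows "0 < x" "x \<le> R"
proof -
  obtain j where j: "x = r j" "1 \<le> j" "j \<le> k" using assms by auto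
  show "0 < x" using r_less[of 0 j] j r_0 by simp
  show "x \<le> R" using r_less[of j k] j by (cases "j = k") auto
qed

lemma R_generator: "R \<in> r ` {1..k}"
  using k_ge_2 by auto

lemma sum_list_generators:
  assumes "set xs \<subseteq> r ` {1..k}"
  shows "int (length xs) \<le> sum_list xs" "sum_list xs \<le> R * int (length xs)"
  using assms
proof (induction xs)
  case (Cons x xs)
  {
    case 1
    then show ?case using Cons generator_bounds(1)[of x] by auto
  next
    case 2
    then show ?case using Cons generator_bounds(2)[of x] by (auto simp: algebra_simps)
  }
qed auto

lemma S_nonneg: "s \<in> S r k \<Longrightarrow> 0 \<le> s"
  using sum_list_generators(1) by (fastforce simp: in_S_iff_list generator_lists_def)

lemma S_zero: "0 \<in> S r k"
  by (auto simp: in_S_iff_list generator_lists_def intro: exI[of _ "[]"])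

lemma S_add: "s \<in> S r k \<Longrightarrow> t \<in> S r k \<Longrightarrow> s + t \<in> S r k"
proof -
  assume "s \<in> S r k" "t \<in> S r k"
  then obtain xs ys where "xs \<in> generator_lists r k s" "ys \<in> generator_lists r k t" by (auto simp: in_S_iff_list)
  then have "xs @ ys \<in> generator_lists r k (s + t)" by (auto simp: generator_lists_def)
  then show ?thesis by (auto simp: in_S_iff_list)
qed

lemma S_generator: "x \<in> r ` {1..k} \<Longrightarrow> x \<in> S r k"
  unfolding in_S_iff_list generator_lists_def by (rule exI[of _ "[x]"]) auto

lemma S_mult: "s \<in> S r k \<Longrightarrow> int a * s \<in> S r k"
  by (induction a) (auto simp: S_zero S_add distrib_right)

lemma mult_R_in_S: "int a * R \<in> S r k"
  by (intro S_mult S_generator R_generator)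

lemma S_dvd: "s \<in> S r k \<Longrightarrow> d dvd s"
proof -
  assume "s \<in> S r k"
  then obtain l :: "nat \<Rightarrow> nat" where "s = (\<Sum>j\<in>{1..k}. int (l j) * r j)"
    by (auto simp: S_def generated_def)
  moreover have "d dvd r j" if "j \<in> {1..k}" for j
    unfolding dgcd_def using that by (intro Gcd_dvd) auto
  ultimately show ?thesis by (auto intro!: dvd_sum)
qed

lemma d_pos: "0 < d"
proof -
  have "d dvd R" using S_dvd[OF S_generator[OF R_generator]] .
  then have "d \<noteq> 0" using R_ge_2 by auto
  moreover have "0 \<le> d" unfolding dgcd_def by simp
  ultimately show ?thesis by simp
qed

lemma d_le_R: "d \<le> R"
  using S_dvd[OF S_generator[OF R_generator]] R_ge_2 by (simp add: zdvd_imp_le)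

lemma le_R_minlen: "s \<in> S r k \<Longrightarrow> s \<le> R * m s"
  by (metis (mono_tags, lifting) mem_Collect_eq obtain_shortest_list generator_lists_def sum_list_generators(2))

text \<open>
  Fewer than \<open>R\<close> entries of a shortest factorization differ from \<open>R\<close>: among \<open>R\<close> smaller generators
  some block has a sum \<open>q R\<close>, and \<open>q\<close> copies of \<open>R\<close> replace it by strictly fewer generators.
\<close>

lemma shortest_list_few_small:
  assumes xs: "xs \<in> generator_lists r k s" and len: "length xs = minlen r k s"
  shows "int (length (filter (\<lambda>x. x \<noteq> R) xs)) < R"
proof (rule ccontr)
  let ?small = "filter (\<lambda>x. x \<noteq> R) xs"
  let ?big = "filter (\<lambda>x. \<not> x \<noteq> R) xs"
  assume "\<not> ?thesis"
  then obtain ys zs us where split: "?small = ys @ zs @ us" and ne: "zs \<noteq> []"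
      and dvd: "R dvd sum_list zs"
    using exists_block_sum_dvd[of R ?small] R_ge_2 by auto
  have gens: "set xs \<subseteq> r ` {1..k}" and sum: "sum_list xs = s"
    using xs by (auto simp: generator_lists_def)
  have subs: "set ys \<union> set zs \<union> set us \<subseteq> set ?small"
    unfolding split by auto
  have zs_small: "x < R \<and> 0 < x" if "x \<in> set zs" for x
  proof -
    from subs that have "x \<in> set xs" "x \<noteq> R" by auto
    with gens generator_bounds[of x] show ?thesis by fastforce
  qed
  have lt: "0 \<le> sum_list zs \<and> sum_list zs < R * int (length zs)" if "zs \<noteq> []" "\<forall>x\<in>set zs. x < R \<and> 0 < x"
    for zs :: "int list"
    using that
  proof (induction zs rule: list_nonempty_induct)
    case (cons x xs)
    then show ?case by (auto simp: algebra_simps)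
  qed simp
  obtain q where q: "sum_list zs = R * q" using dvd by (auto simp: dvd_def)
  have "0 \<le> R * q" "R * q < R * int (length zs)"
    using lt[OF ne] zs_small q by auto
  then have q0: "0 \<le> q" "q < int (length zs)"
    using R_ge_2 by (auto simp: zero_le_mult_iff)
  let ?new = "replicate (nat q) R @ ys @ us @ ?big"
  have "sum_list xs = sum_list (filter Q xs) + sum_list (filter (\<lambda>x. \<not> Q x) xs)"
    for Q and xs :: "int list"
    by (induction xs) auto
  from this[of xs "\<lambda>x. x \<noteq> R"] have "s = sum_list ?small + sum_list ?big"
    unfolding sum .
  then have "sum_list ?new = s"
    using q q0(1) by (simp add: split sum_list_replicate mult.commute)
  moreover have "set ?new \<subseteq> r ` {1..k}"
    using subs gens R_generator by auto
  ultimately have "?new \<in> generator_lists r k s" by (simp add: generator_lists_def)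
  then have "length xs \<le> length ?new" using len minlen_le_length by metis
  moreover have "length xs = length ?small + length ?big"
    using sum_length_filter_compl[of "\<lambda>x. x \<noteq> R" xs] by simp
  ultimately show False
    using q0 by (simp add: split)
qed

text \<open>The copies of \<open>R\<close> in a shortest factorization add up to at most \<open>s\<close>, and there are fewer than
  \<open>R\<close> other entries.\<close>

lemma R_minlen_le:
  assumes "s \<in> S r k"
  shows "R * m s \<le> s + R * R"
proof -
  obtain xs where xs: "xs \<in> generator_lists r k s" "length xs = minlen r k s"
    using obtain_shortest_list[OF assms] .
  let ?small = "filter (\<lambda>x. x \<noteq> R) xs"
  have few: "int (length ?small) < R"
    using shortest_list_few_small[OF xs] .
  have "R * int (length xs) - R * int (length (filter (\<lambda>x. x \<noteq> R) xs)) \<le> sum_list xs"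
    if "set xs \<subseteq> r ` {1..k}" for xs
    using that
  proof (induction xs)
    case (Cons x xs)
    then show ?case using generator_bounds(1)[of x] by (auto simp: algebra_simps)
  qed simp
  from this[of xs] xs have "R * m s - R * int (length ?small) \<le> s"
    by (simp add: generator_lists_def)
  moreover have "R * int (length ?small) \<le> R * R"
    using few R_ge_2 by (intro mult_left_mono) auto
  ultimately show ?thesis by linarith
qed

text \<open>A sum of fewer than \<open>R\<close> generators is smaller than \<open>R\<^sup>2\<close>, so a shortest factorization of
  \<open>s \<ge> R\<^sup>2\<close> contains \<open>R\<close>.\<close>

lemma minlen_minus_R:
  assumes s: "s \<in> S r k" and large: "R * R \<le> s"
  shows "s - R \<in> S r k" "m s = m (s - R) + 1"
proof -
  obtain xs where xs: "xs \<in> generator_lists r k s" "length xs = minlen r k s"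
    using obtain_shortest_list[OF s] .
  have "R \<in> set xs"
  proof (rule ccontr)
    assume "R \<notin> set xs"
    then have "filter (\<lambda>x. x \<noteq> R) xs = xs"
      by (auto simp: filter_id_conv)
    then have "m s < R" using shortest_list_few_small[OF xs] xs(2) by simp
    then have "R * m s < R * R" using R_ge_2 by simp
    with le_R_minlen[OF s] large show False by simp
  qed
  then obtain us vs where split: "xs = us @ R # vs" by (auto dest: split_list)
  then have rem: "us @ vs \<in> generator_lists r k (s - R)"
    using xs(1) by (auto simp: generator_lists_def)
  then show inS: "s - R \<in> S r k" by (auto simp: in_S_iff_list)
  have le: "minlen r k (s - R) + 1 \<le> length xs"
    using minlen_le_length[OF rem] split by simp
  obtain ys where ys: "ys \<in> generator_lists r k (s - R)" "length ys = minlen r k (s - R)"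
    using obtain_shortest_list[OF inS] .
  from ys(1) have "R # ys \<in> generator_lists r k s" using R_generator by (auto simp: generator_lists_def)
  from minlen_le_length[OF this] ys(2) have "minlen r k s \<le> minlen r k (s - R) + 1" by simp
  with le xs(2) show "m s = m (s - R) + 1" by linarith
qed

lemma minlen_add_mult_R:
  assumes "s \<in> S r k" "R * R \<le> s"
  shows "s + int t * R \<in> S r k \<and> m (s + int t * R) = m s + int t"
proof (induction t)
  case (Suc t)
  let ?s = "s + int (Suc t) * R"
  have eq: "?s - R = s + int t * R" by (simp add: algebra_simps)
  have S: "?s \<in> S r k" using assms(1) by (intro S_add mult_R_in_S)
  have "0 \<le> int (Suc t) * R" using R_ge_2 by simp
  then have "R * R \<le> ?s" using assms(2) by linarith
  from minlen_minus_R(2)[OF S this] have "m ?s = m (s + int t * R) + 1" by (simp only: eq)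
  with conjunct2[OF Suc] S show ?case by linarith
qed (use assms in simp)

text \<open>Bezout, with the integer coefficients reduced modulo \<open>R\<close> to make them nonnegative.\<close>

lemma S_meets_class:
  assumes "d dvd x"
  shows "\<exists>y\<in>S r k. [y = x] (mod R)"
proof -
  define T where "T = {x. \<exists>y\<in>S r k. [y = x] (mod R)}"
  have add: "a + b \<in> T" if "a \<in> T" "b \<in> T" for a b
    using that S_add cong_add unfolding T_def by blast
  have mult: "u * a \<in> T" if "a \<in> T" for u a
  proof -
    obtain y where y: "y \<in> S r k" "[y = a] (mod R)" using \<open>a \<in> T\<close> by (auto simp: T_def)
    have "int (nat (u mod R)) * y \<in> S r k" using y(1) by (rule S_mult)
    moreover have "[int (nat (u mod R)) * y = u * a] (mod R)"
      using y(2) R_ge_2 by (intro cong_mult) (auto simp: cong_def)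
    ultimately show ?thesis by (auto simp: T_def)
  qed
  have "Gcd A \<in> T" if "finite A" "A \<subseteq> r ` {1..k}" for A
    using that
  proof (induction A rule: finite_induct)
    case empty
    then show ?case using S_zero by (auto simp: T_def intro!: bexI[of _ 0])
  next
    case (insert a A)
    have "a \<in> T" using insert.prems S_generator by (auto simp: T_def intro!: bexI[of _ a])
    moreover obtain u v where "u * a + v * Gcd A = gcd a (Gcd A)"
      using bezout_int by blast
    moreover have "Gcd A \<in> T" using insert by simp
    ultimately show ?case using add[OF mult mult, of a "Gcd A" u v] by simp
  qed
  then have "d \<in> T" unfolding dgcd_def by simp
  with assms mult have "x \<in> T" by (metis dvdE mult.commute)
  then show ?thesis by (simp add: T_def)
qed

text \<open>An element of \<open>S\<close> in the class of \<open>x\<close> modulo \<open>R\<close> can be lowered in steps of \<open>R\<close> within \<open>S\<close>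
  as long as it is at least \<open>R\<^sup>2\<close>, hence until it is at most \<open>x\<close>; adding copies of \<open>R\<close> then reaches \<open>x\<close>.\<close>

lemma large_multiple_in_S:
  assumes dvd: "d dvd x" and large: "R * R \<le> x"
  shows "x \<in> S r k"
proof -
  have "y \<in> S r k \<Longrightarrow> [y = x] (mod R) \<Longrightarrow> x \<in> S r k" for y
  proof (induction "nat y" arbitrary: y rule: less_induct)
    case less
    show ?case
    proof (cases "y \<le> x")
      case True
      have "R dvd x - y" using less.prems(2) by (metis cong_iff_dvd_diff cong_sym)
      then obtain q where q: "x = y + R * q" by (metis add_diff_cancel_left' diff_add_cancel dvdE add.commute)
      then have "0 \<le> q" using True R_ge_2 by (simp add: zero_le_mult_iff)
      then have "x = y + int (nat q) * R" using q by simp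
      then show ?thesis
        using S_add[OF less.prems(1) mult_R_in_S, of "nat q"] by (simp only:)
    next
      case False
      then have "R * R \<le> y" using large by simp
      then have "y - R \<in> S r k" using minlen_minus_R(1) less.prems by blast
      moreover have "nat (y - R) < nat y" using R_ge_2 S_nonneg[OF calculation] by simp
      moreover have "[y - R = x] (mod R)" using less.prems(2) by (simp add: cong_def)
      ultimately show ?thesis using less.hyps by blast
    qed
  qed
  with S_meets_class[OF dvd] show ?thesis by blast
qed

section \<open>Shifted semigroups and their pseudo-Frobenius numbers\<close>

text \<open>Here \<open>a\<close> counts all generators, the generator \<open>n = n + r 0\<close> included, which fills up a
  factorization of \<open>s\<close> of length \<open>m s\<close> to any larger length.\<close>

lemma M_iff: "x \<in> M r k n \<longleftrightarrow> (\<exists>a s. x = a * n + s \<and> s \<in> S r k \<and> m s \<le> a)" (is "_ \<longleftrightarrow> ?A")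
proof
  have ins: "{0..k} = insert 0 {1..k}" by auto
  have sum: "(\<Sum>j\<in>{0..k}. int (l j) * (n + r j))
      = (int (l 0) + int (\<Sum>j\<in>{1..k}. l j)) * n + (\<Sum>j\<in>{1..k}. int (l j) * r j)" for l :: "nat \<Rightarrow> nat"
    unfolding ins by (simp add: r_0 sum.distrib sum_distrib_left algebra_simps)
  {
    assume "x \<in> M r k n"
    then obtain l :: "nat \<Rightarrow> nat" where l: "x = (\<Sum>j\<in>{0..k}. int (l j) * (n + r j))"
      by (auto simp: M_def generated_def)
    let ?s = "\<Sum>j\<in>{1..k}. int (l j) * r j"
    have "?s \<in> S r k" by (auto simp: S_def generated_def)
    moreover have "minlen r k ?s \<le> (\<Sum>j\<in>{1..k}. l j)"
      unfolding minlen_def by (rule Least_le) blast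
    moreover have "x = (int (l 0) + int (\<Sum>j\<in>{1..k}. l j)) * n + ?s"
      using l unfolding sum .
    moreover have "m ?s \<le> int (l 0) + int (\<Sum>j\<in>{1..k}. l j)"
      using calculation(2) by linarith
    ultimately show ?A by blast
  next
    assume ?A
    then obtain a s where as: "x = a * n + s" "s \<in> S r k" "m s \<le> a" by blast
    have "\<exists>xs\<in>generator_lists r k s. length xs = minlen r k s"
      using obtain_shortest_list[OF as(2)] by blast
    then obtain l :: "nat \<Rightarrow> nat" where l: "s = (\<Sum>j\<in>{1..k}. int (l j) * r j)"
        "minlen r k s = (\<Sum>j\<in>{1..k}. l j)"
      unfolding factorization_iff_list[symmetric] by blast
    let ?l = "l(0 := nat (a - m s))"
    have same: "(\<Sum>j\<in>{1..k}. ?l j) = (\<Sum>j\<in>{1..k}. l j)"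
        "(\<Sum>j\<in>{1..k}. int (?l j) * r j) = (\<Sum>j\<in>{1..k}. int (l j) * r j)"
      by (auto intro!: sum.cong)
    have "x = (\<Sum>j\<in>{0..k}. int (?l j) * (n + r j))"
      unfolding sum same l(1)[symmetric] l(2)[symmetric] using as by simp
    then show "x \<in> M r k n" unfolding M_def generated_def by blast
  }
qed

lemma M_I: "s \<in> S r k \<Longrightarrow> m s \<le> a \<Longrightarrow> a * n + s \<in> M r k n"
  unfolding M_iff by blast

lemma M_nonneg: "0 \<le> n \<Longrightarrow> x \<in> M r k n \<Longrightarrow> 0 \<le> x"
  unfolding M_iff using S_nonneg by fastforce

lemma M_add_multiple:
  assumes "x \<in> M r k n" "0 \<le> t"
  shows "x + t * n \<in> M r k n"
proof -
  obtain a s where "x = a * n + s" "s \<in> S r k" "m s \<le> a"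
    using assms(1) by (auto simp: M_iff)
  with M_I[of s "a + t" n] assms(2) show ?thesis by (simp add: algebra_simps)
qed

lemma shift_in_M: "n \<in> M r k n"
proof -
  have "minlen r k 0 = 0"
    using minlen_le_length[of "[]" r k 0] by (simp add: generator_lists_def)
  with M_I[of 0 1 n] S_zero show ?thesis by simp
qed

text \<open>If \<open>f < g\<close> in the same class, then \<open>g\<close> arises from \<open>f + n \<in> M\<^sub>n\<close> by adding copies of \<open>n\<close>.\<close>

lemma PF_unique_in_class:
  assumes f: "f \<in> PF (M r k n)" and g: "g \<in> PF (M r k n)" and fg: "[f = g] (mod n)" and n: "0 < n"
  shows "f = g"
proof -
  have no_less: False
    if f: "f \<in> PF (M r k n)" and g: "g \<in> PF (M r k n)" and fg: "[f = g] (mod n)" and less: "f < g" for f g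
  proof -
    have "f + n \<in> M r k n"
      using f shift_in_M n by (simp add: PF_def)
    moreover obtain t where t: "g = f + t * n"
      using cong_int_obtain[OF cong_sym[OF fg]] .
    then have "0 < t" using less n by (simp add: zero_less_mult_iff)
    ultimately have "f + n + (t - 1) * n \<in> M r k n" by (intro M_add_multiple) auto
    then have "g \<in> M r k n" by (simp add: t algebra_simps)
    then show False using g by (simp add: PF_def)
  qed
  show ?thesis
    using no_less[OF f g fg] no_less[OF g f cong_sym[OF fg]]
    by (cases f g rule: linorder_cases) auto
qed

end

section \<open>The Frobenius number as a maximum over the Apery set\<close>

text \<open>The bound \<open>4 R\<^sup>2\<close> makes the error \<open>R\<^sup>2\<close> in \<open>s \<le> R m(s) \<le> s + R\<^sup>2\<close> negligible wherever values of \<open>m\<close>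
  are compared; it follows from \<open>R\<^sup>4 \<le> n\<close> as \<open>R \<ge> 2\<close>, and it passes to \<open>n + R\<close>.\<close>

locale shifted_semigroup = shift_generators +
  fixes n :: int
  assumes n_large: "4 * (R * R) \<le> n"
    and coprime: "coprime n d"
begin

abbreviation w :: "int \<Rightarrow> int" where "w i \<equiv> i + m i * n"

lemma RR_ge: "2 * R \<le> R * R"
  using R_ge_2 by (intro mult_right_mono) auto

lemma n_pos: "0 < n"
  using n_large RR_ge R_ge_2 by linarith

lemma n_le_dn: "n \<le> d * n"
  using d_pos n_pos by simp

lemma dn_in_S: "d * n \<in> S r k"
proof (rule large_multiple_in_S)
  show "R * R \<le> d * n" using n_le_dn n_large RR_ge R_ge_2 by linarith
qed simp

lemma Ap_in_S: "i \<in> Ap (S r k) (d * n) \<Longrightarrow> i \<in> S r k"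
  by (simp add: Ap_def)

text \<open>Since \<open>gcd n d = 1\<close> and \<open>S\<close> lies in \<open>d\<int>\<close>, congruence modulo \<open>n\<close> is congruence modulo \<open>dn\<close>
  on \<open>S\<close>.\<close>

lemma Ap_least_in_class:
  assumes i: "i \<in> Ap (S r k) (d * n)" and s: "s \<in> S r k" and c: "[s = i] (mod n)"
  obtains t where "0 \<le> t" "s = i + t * (d * n)"
proof -
  have "n dvd s - i" using c by (simp add: cong_iff_dvd_diff)
  moreover have "d dvd s - i" using S_dvd s Ap_in_S[OF i] by (intro dvd_diff) auto
  ultimately have "d * n dvd s - i"
    using coprime by (intro divides_mult) (auto simp: coprime_commute)
  then obtain t where "s - i = d * n * t" ..
  then have t: "s = i + t * (d * n)" by (simp add: algebra_simps)
  have "0 \<le> t"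
  proof (rule ccontr)
    assume "\<not> 0 \<le> t"
    then have "i - d * n = s + int (nat (- t - 1)) * (d * n)"
      unfolding t by (simp add: algebra_simps)
    then have "i - d * n \<in> S r k"
      using S_add[OF s S_mult[OF dn_in_S]] by metis
    with i show False by (simp add: Ap_def)
  qed
  with t that show ?thesis by blast
qed

lemma Ap_unique_in_class:
  assumes "i \<in> Ap (S r k) (d * n)" "j \<in> Ap (S r k) (d * n)" "[i = j] (mod n)"
  shows "i = j"
proof -
  obtain t where "0 \<le> t" "i = j + t * (d * n)"
    using Ap_least_in_class[OF assms(2) Ap_in_S[OF assms(1)] assms(3)] .
  moreover obtain u where "0 \<le> u" "j = i + u * (d * n)"
    using Ap_least_in_class[OF assms(1) Ap_in_S[OF assms(2)] cong_sym[OF assms(3)]] .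
  moreover have "0 \<le> t * (d * n)" "0 \<le> u * (d * n)"
    using calculation d_pos n_pos by auto
  ultimately show ?thesis by linarith
qed

text \<open>As \<open>d\<close> is invertible modulo \<open>n\<close>, the class of \<open>x\<close> contains a large multiple of \<open>d\<close>, hence an
  element of \<open>S\<close>; subtracting \<open>dn\<close> as long as possible ends in the Apery set.\<close>

lemma Ap_meets_class: "\<exists>i\<in>Ap (S r k) (d * n). [x = i] (mod n)"
proof -
  have descend: "y \<in> S r k \<Longrightarrow> [x = y] (mod n) \<Longrightarrow> ?thesis" for y
  proof (induction "nat y" arbitrary: y rule: less_induct)
    case less
    show ?case
    proof (cases "y - d * n \<in> S r k")
      case True
      moreover have "nat (y - d * n) < nat y"
        using S_nonneg[OF True] n_le_dn n_pos by linarith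
      moreover have "[x = y - d * n] (mod n)"
        using less.prems(2) by (simp add: cong_def mod_diff_eq[symmetric])
      ultimately show ?thesis using less.hyps by blast
    next
      case False
      with less.prems show ?thesis by (auto simp: Ap_def)
    qed
  qed
  obtain u where u: "[d * u = 1] (mod n)"
    using cong_solve_coprime_int coprime by (metis coprime_commute)
  \<comment> \<open>The second summand is a multiple of \<open>n\<close> that makes \<open>c\<close> at least \<open>n\<close>, whatever the sign of
    \<open>u x\<close>.\<close>
  define c where "c = d * (u * x) + (\<bar>d * (u * x)\<bar> + 1) * (d * n)"
  have "[d * u * x = 1 * x] (mod n)" using u by (intro cong_mult) auto
  then have "n dvd d * (u * x) - x"
    by (simp add: cong_iff_dvd_diff mult.assoc)
  moreover have "n dvd (\<bar>d * (u * x)\<bar> + 1) * (d * n)" by simp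
  moreover have "c - x = (d * (u * x) - x) + (\<bar>d * (u * x)\<bar> + 1) * (d * n)"
    by (simp add: c_def)
  ultimately have "n dvd c - x" by (metis dvd_add)
  then have "[x = c] (mod n)"
    by (metis cong_iff_dvd_diff cong_sym)
  moreover have "c \<in> S r k"
  proof (rule large_multiple_in_S)
    show "d dvd c" unfolding c_def by simp
    have "\<bar>d * (u * x)\<bar> * 1 \<le> \<bar>d * (u * x)\<bar> * (d * n)"
      using n_le_dn n_pos by (intro mult_left_mono) linarith+
    then show "R * R \<le> c"
      unfolding c_def distrib_right using n_le_dn n_large RR_ge R_ge_2 by linarith
  qed
  ultimately show ?thesis by (intro descend)
qed

lemma bound_of_Ap:
  assumes "i \<in> Ap (S r k) (d * n)"
  shows "i < d * n + R * R"
proof (rule ccontr)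
  assume "\<not> ?thesis"
  then have "i - d * n \<in> S r k"
    using S_dvd[OF Ap_in_S[OF assms]] by (intro large_multiple_in_S) auto
  with assms show False by (simp add: Ap_def)
qed

lemma finite_Ap: "finite (Ap (S r k) (d * n))"
proof (rule finite_subset)
  show "Ap (S r k) (d * n) \<subseteq> {0..d * n + R * R}"
    using bound_of_Ap S_nonneg Ap_in_S by fastforce
qed simp

text \<open>Adding \<open>t dn\<close> with \<open>t \<ge> 1\<close> raises \<open>R m\<close> by at least \<open>dn - R\<^sup>2 \<ge> 0\<close>, so \<open>m\<close> does
  not even decrease.\<close>

lemma minlen_le_add_multiple:
  assumes i: "i \<in> S r k" and t: "0 \<le> t"
  shows "m i \<le> m (i + t * (d * n)) + t * d"
proof (cases "t = 0")
  case False
  with t have "1 \<le> t" by simp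
  have "i + t * (d * n) \<in> S r k"
    using S_add[OF i S_mult[OF dn_in_S, of "nat t"]] t by simp
  from le_R_minlen[OF this] R_minlen_le[OF i]
  have "R * m i \<le> R * m (i + t * (d * n)) + (R * R - t * (d * n))" by linarith
  moreover have "1 * (d * n) \<le> t * (d * n)"
    using \<open>1 \<le> t\<close> d_pos n_pos by (intro mult_right_mono) auto
  ultimately have "R * m i \<le> R * m (i + t * (d * n))"
    using n_le_dn n_large RR_ge R_ge_2 by linarith
  then have "m i \<le> m (i + t * (d * n))" using R_ge_2 by simp
  moreover have "0 \<le> t * d" using t d_pos by simp
  ultimately show ?thesis by linarith
qed simp

text \<open>The least element of \<open>M\<^sub>n\<close> in the class of \<open>i\<close> is \<open>w i\<close>: any other \<open>a n + s\<close> in this class has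
  \<open>s = i + t dn\<close> with \<open>t \<ge> 0\<close>.\<close>

lemma M_in_class_iff:
  assumes i: "i \<in> Ap (S r k) (d * n)" and x: "[x = i] (mod n)"
  shows "x \<in> M r k n \<longleftrightarrow> w i \<le> x"
proof
  assume "x \<in> M r k n"
  then obtain a s where as: "x = a * n + s" "s \<in> S r k" "m s \<le> a"
    by (auto simp: M_iff)
  then have "[s = i] (mod n)" using x by (simp add: cong_def)
  then obtain t where t: "0 \<le> t" "s = i + t * (d * n)"
    using Ap_least_in_class[OF i as(2)] by blast
  have "m i \<le> a + t * d"
    using minlen_le_add_multiple[OF Ap_in_S[OF i] t(1)] as(3)[unfolded t(2)] by linarith
  then have "m i * n \<le> (a + t * d) * n" using n_pos by (intro mult_right_mono) auto
  then show "w i \<le> x" unfolding as t by (simp add: algebra_simps)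
next
  assume le: "w i \<le> x"
  have "[x = w i] (mod n)" using x by (simp add: cong_def)
  then obtain t where t: "x = w i + t * n"
    by (rule cong_int_obtain)
  then have "0 \<le> t" using le n_pos by (simp add: zero_le_mult_iff)
  then show "x \<in> M r k n"
    using M_I[OF Ap_in_S[OF i], of "m i + t" n] by (simp add: t algebra_simps)
qed

lemma Frob_eqI:
  assumes i: "i \<in> Ap (S r k) (d * n)" and max: "\<And>j. j \<in> Ap (S r k) (d * n) \<Longrightarrow> w j \<le> w i"
  shows "Frob (M r k n) = w i - n"
  unfolding Frob_def
proof (rule Greatest_equality)
  have "[w i - n = i] (mod n)" by (simp add: cong_iff_dvd_diff)
  then show "w i - n \<notin> M r k n" using M_in_class_iff[OF i] n_pos by simp
next
  fix x assume x: "x \<notin> M r k n"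
  obtain j where j: "j \<in> Ap (S r k) (d * n)" "[x = j] (mod n)"
    using Ap_meets_class by blast
  have "[x = w j] (mod n)" using j(2) by (simp add: cong_def)
  then obtain t where t: "x = w j + t * n"
    by (rule cong_int_obtain)
  have "x < w j" using x M_in_class_iff[OF j] by simp
  with t n_pos have "t < 0" by (simp add: mult_less_0_iff)
  then have "t * n \<le> - 1 * n" using n_pos by (intro mult_right_mono) auto
  then show "x \<le> w i - n" using t max[OF j(1)] by linarith
qed

lemma Frob_class_maximal:
  assumes i: "i \<in> Ap (S r k) (d * n)" and c: "[Frob (M r k n) = i] (mod n)"
    and j: "j \<in> Ap (S r k) (d * n)"
  shows "w j \<le> w i"
proof -
  let ?W = "w ` Ap (S r k) (d * n)"
  have "Max ?W \<in> ?W" using finite_Ap i by (intro Max_in) auto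
  then obtain i0 where i0: "i0 \<in> Ap (S r k) (d * n)" and w_i0: "w i0 = Max ?W" by force
  have max: "w j \<le> w i0" if "j \<in> Ap (S r k) (d * n)" for j
    unfolding w_i0 using finite_Ap that by (intro Max_ge) auto
  have "Frob (M r k n) = w i0 - n" by (rule Frob_eqI[OF i0 max])
  then have "[Frob (M r k n) = i0] (mod n)" by (simp add: cong_iff_dvd_diff)
  then have "i = i0"
    using Ap_unique_in_class[OF i i0] cong_trans[OF cong_sym[OF c]] by blast
  with max j show ?thesis by simp
qed

lemma Frob_eq:
  assumes "i \<in> Ap (S r k) (d * n)" "[Frob (M r k n) = i] (mod n)"
  shows "Frob (M r k n) = w i - n"
  using Frob_eqI[OF assms(1)] Frob_class_maximal[OF assms] by blast

text \<open>Adding a positive number to the largest gap leaves the set of gaps.\<close>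

lemma Frob_in_PF: "Frob (M r k n) \<in> PF (M r k n)"
proof -
  obtain i where i: "i \<in> Ap (S r k) (d * n)" "[Frob (M r k n) = i] (mod n)"
    using Ap_meets_class by blast
  have greater: "x \<in> M r k n" if less: "Frob (M r k n) < x" for x
  proof -
    obtain j where j: "j \<in> Ap (S r k) (d * n)" "[x = j] (mod n)"
      using Ap_meets_class by blast
    have "[x = w j] (mod n)" using j(2) by (simp add: cong_def)
    then obtain t where t: "x = w j + t * n"
      by (rule cong_int_obtain)
    have "w j - n < x" using less Frob_eq[OF i] Frob_class_maximal[OF i j(1)] by linarith
    with t n_pos have "0 < (t + 1) * n" by (simp add: algebra_simps)
    then have "0 \<le> t" using n_pos by (simp add: zero_less_mult_iff)
    then have "0 \<le> t * n" using n_pos by simp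
    then show ?thesis using M_in_class_iff[OF j] t by simp
  qed
  have "Frob (M r k n) \<notin> M r k n"
    using M_in_class_iff[OF i] Frob_eq[OF i] n_pos by simp
  moreover have "0 < h" if "h \<in> M r k n" "h \<noteq> 0" for h
    using M_nonneg[OF _ that(1)] n_pos that(2) by simp
  ultimately show ?thesis using greater by (auto simp: PF_def)
qed

section \<open>The class of the Frobenius number under a shift\<close>

text \<open>
  Otherwise \<open>w\<close> takes a larger value at some \<open>j > i\<close> in the Apery set with \<open>m j \<ge> m i\<close>. For \<open>i \<ge> R\<^sup>2\<close>
  take \<open>j = i + R\<close>, by the recursion for \<open>m\<close>. For smaller \<open>i\<close> the recursion may fail, but then \<open>m i\<close>
  is less than \<open>2 R\<close>, and the largest multiple of \<open>d\<close> below \<open>dn\<close> needs at least that many generators.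
\<close>

lemma Frob_class_large:
  assumes i: "i \<in> Ap (S r k) (d * n)" and c: "[Frob (M r k n) = i] (mod n)"
  shows "d * n - R \<le> i"
proof (rule ccontr)
  assume "\<not> ?thesis"
  then have small: "i < d * n - R" by simp
  have "\<exists>j\<in>Ap (S r k) (d * n). i < j \<and> m i \<le> m j"
  proof (cases "R * R \<le> i")
    case True
    have j: "i + R \<in> S r k" "m (i + R) = m i + 1"
      using minlen_add_mult_R[OF Ap_in_S[OF i] True, of 1] by auto
    have "i + R - d * n \<notin> S r k" using small S_nonneg by force
    with j R_ge_2 show ?thesis by (intro bexI[of _ "i + R"]) (auto simp: Ap_def)
  next
    case False
    let ?j = "d * n - d"
    have large: "2 * (R * R) \<le> ?j"
      using n_le_dn n_large RR_ge R_ge_2 d_le_R by linarith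
    have j: "?j \<in> S r k"
    proof (rule large_multiple_in_S)
      show "R * R \<le> ?j" using large RR_ge R_ge_2 by linarith
    qed simp
    have "R * m i \<le> R * m ?j"
      using R_minlen_le[OF Ap_in_S[OF i]] le_R_minlen[OF j] large False by linarith
    then have "m i \<le> m ?j" using R_ge_2 by simp
    moreover have "?j - d * n \<notin> S r k" using S_nonneg d_pos by force
    ultimately show ?thesis using j large False d_le_R small
      by (intro bexI[of _ ?j]) (auto simp: Ap_def)
  qed
  then obtain j where j: "j \<in> Ap (S r k) (d * n)" "i < j" "m i \<le> m j" by blast
  have "m i * n \<le> m j * n" using j(3) n_pos by simp
  with Frob_class_maximal[OF i c j(1)] j(2) show False by simp
qed

lemma Frob_class_in_P'':
  assumes i: "i \<in> Ap (S r k) (d * n)" and c: "[Frob (M r k n) = i] (mod n)"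
  shows "i \<in> P'' r k n"
  using assms Frob_in_PF Frob_class_large[OF assms] by (auto simp: P''_def P_def)

lemma next_shift: "shifted_semigroup r k (n + R)"
proof unfold_locales
  show "4 * (R * R) \<le> n + R" using n_large R_ge_2 by simp
  obtain q where "R = d * q" using S_dvd[OF S_generator[OF R_generator]] ..
  then have "gcd (n + R) d = gcd n d"
    by (metis gcd.commute gcd_add_mult add.commute mult.commute)
  then show "coprime (n + R) d" using coprime by (simp add: coprime_iff_gcd_eq_1)
qed

lemma Frob_class_minlen:
  assumes i: "i \<in> Ap (S r k) (d * n)" and c: "[Frob (M r k n) = i] (mod n)"
  shows "m (i + d * R) = m i + d"
proof -
  have "R * R \<le> i"
    using Frob_class_large[OF assms] n_le_dn n_large RR_ge R_ge_2 by linarith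
  from minlen_add_mult_R[OF Ap_in_S[OF i] this, of "nat d"] d_pos show ?thesis by simp
qed

text \<open>
  Let \<open>j\<close> compete with \<open>i + dR\<close> for the maximum of \<open>w\<close> at \<open>n + R\<close>. If \<open>j\<close> is large, then \<open>j = j0 + dR\<close>
  with \<open>j0\<close> a competitor of \<open>i\<close> at \<open>n\<close>, and up to a common summand the new values are \<open>w j0 + R m(j0)\<close>
  and \<open>w i + R m(i)\<close>. Here \<open>m(j0) > m(i)\<close> is impossible: as \<open>w j0 \<le> w i\<close>, it would force
  \<open>i \<ge> j0 + n\<close>, and then \<open>i\<close> needs at least as many generators as \<open>j0\<close>. If \<open>j\<close> is small, both \<open>j\<close> and \<open>m(j)\<close> are
  too small to compete.
\<close>

lemma Frob_class_next:
  assumes i: "i \<in> Ap (S r k) (d * n)" and c: "[Frob (M r k n) = i] (mod n)"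
  shows "i + d * R \<in> Ap (S r k) (d * (n + R))"
    and "Frob (M r k (n + R)) = i + d * R + (m i + d - 1) * (n + R)"
    and "[Frob (M r k (n + R)) = i + d * R] (mod (n + R))"
proof -
  interpret nxt: shifted_semigroup r k "n + R" by (rule next_shift)
  have large: "d * n - R \<le> i" by (rule Frob_class_large[OF i c])
  note m_next = Frob_class_minlen[OF i c]
  have S_next: "i + d * R \<in> S r k"
    using S_add[OF Ap_in_S[OF i] mult_R_in_S[of "nat d"]] d_pos by simp
  then show Ap_next: "i + d * R \<in> Ap (S r k) (d * (n + R))"
    using i by (simp add: Ap_def algebra_simps)
  have dR: "R \<le> d * R" "d * R \<le> R * R"
    using d_pos d_le_R R_ge_2 by auto
  have "nxt.w j \<le> nxt.w (i + d * R)" if j: "j \<in> Ap (S r k) (d * (n + R))" for j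
  proof (cases "R * R + d * R \<le> j")
    case True
    define j0 where "j0 = j - d * R"
    have j_eq: "j = j0 + d * R" by (simp add: j0_def)
    have j0_large: "R * R \<le> j0" using True by (simp add: j0_def)
    have j0_S: "j0 \<in> S r k"
      using S_dvd[OF nxt.Ap_in_S[OF j]] j0_large by (intro large_multiple_in_S) (auto simp: j0_def)
    have j0_Ap: "j0 \<in> Ap (S r k) (d * n)"
      using j j0_S by (simp add: Ap_def j0_def algebra_simps)
    have m_j: "m j = m j0 + d"
      using minlen_add_mult_R[OF j0_S j0_large, of "nat d"] d_pos by (simp add: j_eq)
    have w_le: "w j0 \<le> w i" by (rule Frob_class_maximal[OF i c j0_Ap])
    have "m j0 \<le> m i"
    proof (rule ccontr)
      assume "\<not> ?thesis"
      then have less: "m i + 1 \<le> m j0" by simp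
      then have "(m i + 1) * n \<le> m j0 * n" using n_pos by (intro mult_right_mono) auto
      with w_le have "j0 + n \<le> i" by (simp add: distrib_right)
      then have "R * m j0 \<le> R * m i"
        using R_minlen_le[OF j0_S] le_R_minlen[OF Ap_in_S[OF i]] n_large RR_ge R_ge_2 by linarith
      with less R_ge_2 show False by simp
    qed
    then have "m j0 * R \<le> m i * R" using R_ge_2 by simp
    with w_le show ?thesis unfolding m_next m_j unfolding j_eq by (simp add: algebra_simps)
  next
    case False
    then have j_small: "j \<le> 2 * (R * R)" using dR by linarith
    have next_large: "4 * (R * R) \<le> i + d * R"
      using large dR n_le_dn n_large by linarith
    have "R * m j \<le> R * m (i + d * R)"
      using R_minlen_le[OF nxt.Ap_in_S[OF j]] le_R_minlen[OF S_next] j_small next_large RR_ge R_ge_2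
      by linarith
    then have "m j \<le> m (i + d * R)" using R_ge_2 by simp
    then have "m j * (n + R) \<le> m (i + d * R) * (n + R)"
      using nxt.n_pos by (intro mult_right_mono) auto
    with j_small next_large RR_ge R_ge_2 show ?thesis by linarith
  qed
  then have "Frob (M r k (n + R)) = nxt.w (i + d * R) - (n + R)"
    by (rule nxt.Frob_eqI[OF Ap_next])
  then show eq: "Frob (M r k (n + R)) = i + d * R + (m i + d - 1) * (n + R)"
    unfolding m_next by (simp add: algebra_simps)
  show "[Frob (M r k (n + R)) = i + d * R] (mod (n + R))"
    unfolding eq by (simp add: cong_iff_dvd_diff)
qed

text \<open>The element of the Apery set congruent to \<open>F(M\<^sub>n)\<close> is unique, and so is a pseudo-Frobenius number
  in a given class modulo \<open>n + R\<close>; this makes the description in \<open>phi\<close> definite.\<close>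

lemma phi_Frob: "phi r k n (Frob (M r k n)) = Frob (M r k (n + R))"
proof -
  interpret nxt: shifted_semigroup r k "n + R" by (rule next_shift)
  obtain i where i: "i \<in> Ap (S r k) (d * n)" "[Frob (M r k n) = i] (mod n)"
    using Ap_meets_class by blast
  have psi: "psi r k n i = i + d * R"
    using Frob_class_large[OF i] by (simp add: psi_def)
  note c_next = Frob_class_next(3)[OF i]
  show ?thesis
    unfolding phi_def
  proof (rule the_equality, safe)
    show "Frob (M r k (n + R)) \<in> PF (M r k (n + R))" by (rule nxt.Frob_in_PF)
    show "\<exists>i\<in>P r k n. [Frob (M r k n) = i] (mod n) \<and>
        [Frob (M r k (n + R)) = psi r k n i] (mod (n + R))"
      using i c_next psi Frob_class_in_P''[OF i] by (intro bexI[of _ i]) (auto simp: P''_def)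
  next
    fix g j
    assume g: "g \<in> PF (M r k (n + R))" "[g = psi r k n j] (mod (n + R))"
      and j: "j \<in> P r k n" "[Frob (M r k n) = j] (mod n)"
    have "j = i"
      using Ap_unique_in_class[OF _ i(1) cong_trans[OF cong_sym[OF j(2)] i(2)]] j(1)
      by (simp add: P_def)
    with g(2) psi have "[g = i + d * R] (mod (n + R))" by simp
    then have "[g = Frob (M r k (n + R))] (mod (n + R))"
      using cong_sym[OF c_next] by (rule cong_trans)
    then show "g = Frob (M r k (n + R))"
      using PF_unique_in_class[OF g(1) nxt.Frob_in_PF] nxt.n_pos by blast
  qed
qed

end

lemma (in shift_generators) Frob_iterated_shift:
  assumes "shifted_semigroup r k n"
    and i: "i \<in> Ap (S r k) (d * n)" and c: "[Frob (M r k n) = i] (mod n)"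
  defines "i' l \<equiv> i + int l * (d * R)" and "n' l \<equiv> n + int l * R"
  shows "shifted_semigroup r k (n' l) \<and>
    i' l \<in> Ap (S r k) (d * n' l) \<and>
    [Frob (M r k (n' l)) = i' l] (mod n' l) \<and>
    m (i' l) = m i + int l * d \<and>
    phi_iter r k n l (Frob (M r k n)) = Frob (M r k (n' l))"
proof (induction l)
  case 0
  then show ?case using assms by simp
next
  case (Suc l)
  then interpret cur: shifted_semigroup r k "n' l" by simp
  have cls: "i' l \<in> Ap (S r k) (d * n' l)" "[Frob (M r k (n' l)) = i' l] (mod n' l)"
    using Suc by auto
  have n_Suc: "n' (Suc l) = n' l + R" and i_Suc: "i' (Suc l) = i' l + d * R"
    by (simp_all add: n'_def i'_def algebra_simps)
  have phi: "phi_iter r k n (Suc l) (Frob (M r k n)) = Frob (M r k (n' l + R))"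
    using cur.phi_Frob Suc by (simp add: n'_def)
  have m_next: "m (i' l + d * R) = m i + int (Suc l) * d"
    using cur.Frob_class_minlen[OF cls] Suc by (simp add: algebra_simps)
  show ?case
    unfolding n_Suc i_Suc
    by (intro conjI cur.next_shift cur.Frob_class_next(1,3)[OF cls] m_next phi)
qed

theorem proposition2p11:
  fixes r :: "nat \<Rightarrow> int" and k :: nat and d n i :: int
  assumes "k \<ge> 2"
    and "r 0 = 0"
    and "strict_mono_on {0..k} r"
    and "d = dgcd r k"
    and "n \<ge> r k ^ 4"
    and "gcd n d = 1"
    and "i \<in> Ap (S r k) (d * n)"
    and "[Frob (M r k n) = i] (mod n)"
  shows "i \<in> P'' r k n \<and>
    (\<forall>l :: nat.
       Frob (M r k (n + int l * r k)) = phi_iter r k n l (Frob (M r k n)) \<and>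
       phi_iter r k n l (Frob (M r k n)) =
         Frob (M r k n) + (int (minlen r k i) + (int l + 1) * d - 1) * int l * r k + int l * d * n)"
proof -
  interpret shift_generators r k
    using assms(1-3) by unfold_locales auto
  have "4 * (r k * r k) \<le> r k ^ 4"
  proof -
    have "2 * 2 \<le> r k * r k" using R_ge_2 by (intro mult_mono) auto
    then have "4 * (r k * r k) \<le> (r k * r k) * (r k * r k)" by (intro mult_right_mono) auto
    then show ?thesis by (simp add: power4_eq_xxxx mult.assoc)
  qed
  then interpret base: shifted_semigroup r k n
    using assms(4-6) by unfold_locales (auto simp: coprime_iff_gcd_eq_1)
  have i: "i \<in> Ap (S r k) (dgcd r k * n)" using assms(4,7) by simp
  note c = assms(8)
  have "Frob (M r k (n + int l * r k)) = phi_iter r k n l (Frob (M r k n)) \<and>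
       phi_iter r k n l (Frob (M r k n)) =
         Frob (M r k n) + (int (minlen r k i) + (int l + 1) * d - 1) * int l * r k + int l * d * n" for l
  proof -
    let ?i' = "i + int l * (dgcd r k * r k)" and ?n' = "n + int l * r k"
    note it = Frob_iterated_shift[OF base.shifted_semigroup_axioms i c, of l]
    then interpret cur: shifted_semigroup r k ?n' by blast
    have m: "int (minlen r k ?i') = int (minlen r k i) + int l * dgcd r k"
      and phi: "phi_iter r k n l (Frob (M r k n)) = Frob (M r k ?n')"
      using it by blast+
    have "Frob (M r k ?n') = cur.w ?i' - ?n'"
      using it by (intro cur.Frob_eq) blast+
    moreover have "Frob (M r k n) = base.w i - n"
      by (rule base.Frob_eq[OF i c])
    ultimately show ?thesis
      unfolding phi m assms(4) by (simp add: algebra_simps)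
  qed
  with base.Frob_class_in_P''[OF i c] show ?thesis by blast
qed

end
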